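(* For every collection of hypermaps $(\sigma,\alpha)$ the following hold: (1) $R(\sigma,\alpha;0,0)$ is the number of spanning hyperforests of $(\sigma,\alpha)$; (2) $R(\sigma,\alpha;0,1)$ is the number of spanning collections of hypermaps of $(\sigma,\alpha)$.
   Context: Permutations act on a finite set and are composed from right to left; $z(\pi)$ is the number of cycles of $\pi$ (fixed points included). A collection of hypermaps $(\sigma,\alpha)$ on a finite set of points is an ordered pair of permutations of that set. Its connected components are the orbits of the permutation group generated by $\sigma$ and $\alpha$ (with the restrictions of $\sigma$ and $\alpha$); their number is $\kappa(\sigma,\alpha)$. It is a hypermap if $\kappa(\sigma,\alpha)=1$. The genus $g(\sigma,\alpha)$ of a hypermap on $n$ points is defined by $n+2-2g(\sigma,\alpha)=z(\sigma)+z(\alpha)+z(\alpha^{-1}\sigma)$. A hypermap is unicellular if it has one face, i.e. $z(\alpha^{-1}\sigma)=1$. A permutation $\beta$ is a refinement of $\alpha$ (written $\beta\le\alpha$) if $\beta$ is obtained by replacing each cycle $\alpha_i$ of $\alpha$ by a permutation $\beta_i$ acting on the same set of $n_i$ points such that $g(\alpha_i,\beta_i)=0$, that is, $z(\beta_i)+z(\beta_i^{-1}\alpha_i)=n_i+1$. The Whitney polynomial of a collection of hypermaps $(\sigma,\alpha)$ on $n$ points is $$R(\sigma,\alpha;u,v)=\sum_{\beta\leq\alpha}u^{\kappa(\sigma,\beta)-\kappa(\sigma,\alpha)}\,v^{\kappa(\sigma,\beta)+n-z(\beta)-z(\sigma)}$$ (as a polynomial; $0^0=1$ in substitutions). A spanning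 collection of hypermaps of $(\sigma,\alpha)$ is a collection $(\sigma,\beta)$ with $\beta\le\alpha$ such that the group generated by $\sigma$ and $\beta$ has the same orbits as the group generated by $\sigma$ and $\alpha$. A hyperforest is a collection of hypermaps each of whose connected components is a unicellular hypermap of genus zero. A spanning hyperforest of $(\sigma,\alpha)$ is a spanning collection of hypermaps $(\sigma,\beta)$ of $(\sigma,\alpha)$ that is a hyperforest. *)

theory Defs
  imports
    "HOL-Combinatorics.Orbits"
    "HOL-Computational_Algebra.Polynomial"
    "HOL-Algebra.Generated_Groups"
    "HOL-Algebra.Group_Action"
begin

text \<open>
  Permutations of a finite set \<open>S\<close> of points are functions \<open>p\<close> with \<open>p permutes S\<close> (the identity
  outside \<open>S\<close>), so that each permutation of \<open>S\<close> is represented by exactly one function. \<open>Orbits.orbit\<close>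
  is the cyclic orbit of one function, \<open>Group_Action.orbit\<close> the orbit of a group action.
  \<open>Hilbert_Choice.inv\<close> is the inverse function, as opposed to the inverse in a \<open>monoid\<close> record.
\<close>

definition cycles :: "'a set \<Rightarrow> ('a \<Rightarrow> 'a) \<Rightarrow> 'a set set" where
  "cycles S p = Orbits.orbit p ` S"

definition z :: "'a set \<Rightarrow> ('a \<Rightarrow> 'a) \<Rightarrow> nat" where
  "z S p = card (cycles S p)"

definition sym_group_on :: "'a set \<Rightarrow> ('a \<Rightarrow> 'a) monoid" where
  "sym_group_on S = \<lparr> carrier = {p. p permutes S}, mult = (\<circ>), one = id \<rparr>"

definition collection_of_hypermaps :: "'a set \<Rightarrow> ('a \<Rightarrow> 'a) \<Rightarrow> ('a \<Rightarrow> 'a) \<Rightarrow> bool" where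
  "collection_of_hypermaps S \<sigma> \<alpha> \<longleftrightarrow> finite S \<and> \<sigma> permutes S \<and> \<alpha> permutes S"

definition generated_group :: "'a set \<Rightarrow> ('a \<Rightarrow> 'a) \<Rightarrow> ('a \<Rightarrow> 'a) \<Rightarrow> ('a \<Rightarrow> 'a) monoid" where
  "generated_group S \<sigma> \<alpha> = (sym_group_on S) \<lparr> carrier := generate (sym_group_on S) {\<sigma>, \<alpha>} \<rparr>"

definition hypermap_components :: "'a set \<Rightarrow> ('a \<Rightarrow> 'a) \<Rightarrow> ('a \<Rightarrow> 'a) \<Rightarrow> 'a set set" where
  "hypermap_components S \<sigma> \<alpha> = Group_Action.orbits (generated_group S \<sigma> \<alpha>) S (\<lambda>g. g)"

definition \<kappa> :: "'a set \<Rightarrow> ('a \<Rightarrow> 'a) \<Rightarrow> ('a \<Rightarrow> 'a) \<Rightarrow> nat" where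
  "\<kappa> S \<sigma> \<alpha> = card (hypermap_components S \<sigma> \<alpha>)"

definition hypermap :: "'a set \<Rightarrow> ('a \<Rightarrow> 'a) \<Rightarrow> ('a \<Rightarrow> 'a) \<Rightarrow> bool" where
  "hypermap S \<sigma> \<alpha> \<longleftrightarrow> collection_of_hypermaps S \<sigma> \<alpha> \<and> \<kappa> S \<sigma> \<alpha> = 1"

text \<open>
  The genus is the solution \<open>g\<close> of \<open>n + 2 - 2 g = z \<sigma> + z \<alpha> + z (\<alpha>\<inverse> \<sigma>)\<close>; it is rational-valued so
  that neither truncation nor a parity argument enters the definition.
\<close>

definition genus :: "'a set \<Rightarrow> ('a \<Rightarrow> 'a) \<Rightarrow> ('a \<Rightarrow> 'a) \<Rightarrow> rat" where
  "genus S \<sigma> \<alpha> =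
     (of_nat (card S) + 2
       - (of_nat (z S \<sigma>) + of_nat (z S \<alpha>) + of_nat (z S (Hilbert_Choice.inv \<alpha> \<circ> \<sigma>)))) / 2"

definition unicellular :: "'a set \<Rightarrow> ('a \<Rightarrow> 'a) \<Rightarrow> ('a \<Rightarrow> 'a) \<Rightarrow> bool" where
  "unicellular S \<sigma> \<alpha> \<longleftrightarrow> z S (Hilbert_Choice.inv \<alpha> \<circ> \<sigma>) = 1"

text \<open>
  \<open>\<beta> ` C = C\<close> says that \<open>\<beta>\<close> restricts to a permutation of the points of the cycle \<open>C\<close> of \<open>\<alpha>\<close>.
\<close>

definition refinement :: "'a set \<Rightarrow> ('a \<Rightarrow> 'a) \<Rightarrow> ('a \<Rightarrow> 'a) \<Rightarrow> bool" where
  "refinement S \<beta> \<alpha> \<longleftrightarrow> \<beta> permutes S \<and>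
     (\<forall>C \<in> cycles S \<alpha>. \<beta> ` C = C \<and> genus C (perm_restrict \<alpha> C) (perm_restrict \<beta> C) = 0)"

text \<open>
  The polynomial in \<open>u\<close> and \<open>v\<close> is an element of \<open>\<int>[v][u]\<close>: \<open>monom (monom 1 j) i\<close> is
  \<open>u ^ i * v ^ j\<close>. The natural-number subtractions in the exponents are never truncated, see
  \<open>\<kappa>_le_if_refinement\<close> and \<open>z_add_z_le\<close> below.
\<close>

definition whitney_polynomial ::
    "'a set \<Rightarrow> ('a \<Rightarrow> 'a) \<Rightarrow> ('a \<Rightarrow> 'a) \<Rightarrow> int poly poly" where
  "whitney_polynomial S \<sigma> \<alpha> =
     (\<Sum>\<beta> | refinement S \<beta> \<alpha>.
        monom (monom 1 (\<kappa> S \<sigma> \<beta> + card S - z S \<beta> - z S \<sigma>)) (\<kappa> S \<sigma> \<beta> - \<kappa> S \<sigma> \<alpha>))"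

definition eval_uv :: "int poly poly \<Rightarrow> int \<Rightarrow> int \<Rightarrow> int" where
  "eval_uv R u v = poly (poly R [:u:]) v"

definition spanning_collection ::
    "'a set \<Rightarrow> ('a \<Rightarrow> 'a) \<Rightarrow> ('a \<Rightarrow> 'a) \<Rightarrow> ('a \<Rightarrow> 'a) \<Rightarrow> bool" where
  "spanning_collection S \<sigma> \<alpha> \<beta> \<longleftrightarrow>
     refinement S \<beta> \<alpha> \<and> hypermap_components S \<sigma> \<beta> = hypermap_components S \<sigma> \<alpha>"

definition hyperforest :: "'a set \<Rightarrow> ('a \<Rightarrow> 'a) \<Rightarrow> ('a \<Rightarrow> 'a) \<Rightarrow> bool" where
  "hyperforest S \<sigma> \<alpha> \<longleftrightarrow> collection_of_hypermaps S \<sigma> \<alpha> \<and>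
     (\<forall>C \<in> hypermap_components S \<sigma> \<alpha>.
        hypermap C (perm_restrict \<sigma> C) (perm_restrict \<alpha> C) \<and>
        unicellular C (perm_restrict \<sigma> C) (perm_restrict \<alpha> C) \<and>
        genus C (perm_restrict \<sigma> C) (perm_restrict \<alpha> C) = 0)"

definition spanning_hyperforest ::
    "'a set \<Rightarrow> ('a \<Rightarrow> 'a) \<Rightarrow> ('a \<Rightarrow> 'a) \<Rightarrow> ('a \<Rightarrow> 'a) \<Rightarrow> bool" where
  "spanning_hyperforest S \<sigma> \<alpha> \<beta> \<longleftrightarrow> spanning_collection S \<sigma> \<alpha> \<beta> \<and> hyperforest S \<sigma> \<beta>"


subsection \<open>The exponents of the Whitney polynomial are nonnegative\<close>

lemma sym_group_on_group: "group (sym_group_on S)"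
  using permutes_inv permutes_inv_o(2)
  by (auto intro!: groupI simp add: sym_group_on_def permutes_compose permutes_id comp_assoc, blast)

lemma sym_group_on_inv:
  assumes "p permutes S"
  shows "m_inv (sym_group_on S) p = Hilbert_Choice.inv p"
proof (rule group.inv_equality[OF sym_group_on_group])
  show "Hilbert_Choice.inv p \<otimes>\<^bsub>sym_group_on S\<^esub> p = \<one>\<^bsub>sym_group_on S\<^esub>"
    using permutes_inv_o(2)[OF assms] by (simp add: sym_group_on_def)
qed (use assms permutes_inv in \<open>auto simp: sym_group_on_def\<close>)

lemma hypermap_components_image:
  "hypermap_components S \<sigma> \<alpha> =
     (\<lambda>x. {g x | g. g \<in> generate (sym_group_on S) {\<sigma>, \<alpha>}}) ` S"
  by (auto simp: hypermap_components_def generated_group_def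
      Group_Action.orbits_def Group_Action.orbit_def)

lemma generate_invariant:
  assumes "g \<in> generate (sym_group_on S) {\<sigma>, \<alpha>}" "\<sigma> permutes S" "\<alpha> permutes S"
    and "\<And>x. F (\<sigma> x) = F x" "\<And>x. F (\<alpha> x) = F x"
  shows "F (g x) = F x"
  using assms(1)
proof (induction arbitrary: x rule: generate.induct)
  case one
  show ?case by (simp add: sym_group_on_def)
next
  case (incl h)
  then have "h = \<sigma> \<or> h = \<alpha>" by simp
  then show ?case using assms(4,5) by (elim disjE) simp_all
next
  case (inv h)
  then have h': "h = \<sigma> \<or> h = \<alpha>" by simp
  have h: "h permutes S" using h' assms(2,3) by blast
  have Fh: "F (h x) = F x" for x using h' assms(4,5) by (elim disjE) simp_all
  have "F (Hilbert_Choice.inv h x) = F (h (Hilbert_Choice.inv h x))" by (simp only: Fh)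
  also have "\<dots> = F x" by (simp only: permutes_inverses(1)[OF h])
  finally show ?case by (simp add: sym_group_on_inv[OF h])
next
  case (eng h1 h2)
  then show ?case by (simp add: sym_group_on_def)
qed

lemma card_image_le_if_factors:
  assumes "finite S" "\<And>x y. x \<in> S \<Longrightarrow> y \<in> S \<Longrightarrow> g x = g y \<Longrightarrow> f x = f y"
  shows "card (f ` S) \<le> card (g ` S)"
proof -
  have "f ` S = (\<lambda>v. f (SOME x. x \<in> S \<and> g x = v)) ` (g ` S)"
  proof -
    have "f (SOME y. y \<in> S \<and> g y = g x) = f x" if "x \<in> S" for x
      by (rule someI2[of _ x]) (use that in \<open>auto intro: assms(2)\<close>)
    then show ?thesis by (simp add: image_image)
  qed
  then show ?thesis using card_image_le[OF finite_imageI[OF assms(1)]] by simp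
qed

lemma card_image_le_\<kappa>:
  assumes "finite S" "\<sigma> permutes S" "\<alpha> permutes S"
    and "\<And>x. F (\<sigma> x) = F x" "\<And>x. F (\<alpha> x) = F x"
  shows "card (F ` S) \<le> \<kappa> S \<sigma> \<alpha>"
  unfolding \<kappa>_def hypermap_components_image
proof (rule card_image_le_if_factors)
  fix x y
  assume eq: "{g x | g. g \<in> generate (sym_group_on S) {\<sigma>, \<alpha>}} =
    {g y | g. g \<in> generate (sym_group_on S) {\<sigma>, \<alpha>}}"
  have "id \<in> generate (sym_group_on S) {\<sigma>, \<alpha>}"
    using generate.one[of "sym_group_on S"] by (simp add: sym_group_on_def)
  then have "x \<in> {g x | g. g \<in> generate (sym_group_on S) {\<sigma>, \<alpha>}}"
    by (intro CollectI exI[of _ id]) simp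
  then obtain g where "g \<in> generate (sym_group_on S) {\<sigma>, \<alpha>}" "x = g y" unfolding eq by blast
  with generate_invariant[where F = F, OF _ assms(2-5)] show "F x = F y" by simp
qed (rule assms)

lemma orbit_apply_eq:
  assumes "finite S" "p permutes S"
  shows "Orbits.orbit p (p x) = Orbits.orbit p x"
proof -
  have "permutation p" using assms by (auto simp: permutation_permutes)
  then show ?thesis by (rule permutation_orbit_step)
qed

lemma generate_orbit_eq:
  assumes "h \<in> generate (sym_group_on S) {\<sigma>, \<alpha>}" "\<sigma> permutes S" "\<alpha> permutes S"
  shows "{g (h x) | g. g \<in> generate (sym_group_on S) {\<sigma>, \<alpha>}} =
    {g x | g. g \<in> generate (sym_group_on S) {\<sigma>, \<alpha>}}" (is "?A = ?B")
proof -
  let ?G = "generate (sym_group_on S) {\<sigma>, \<alpha>}"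
  have sub: "{\<sigma>, \<alpha>} \<subseteq> carrier (sym_group_on S)" using assms by (auto simp: sym_group_on_def)
  have comp: "g1 \<circ> g2 \<in> ?G" if "g1 \<in> ?G" "g2 \<in> ?G" for g1 g2
    using generate.eng[OF that] by (simp add: sym_group_on_def)
  have hp: "h permutes S"
    using group.generate_in_carrier[OF sym_group_on_group sub assms(1)]
    by (simp add: sym_group_on_def)
  have hi: "Hilbert_Choice.inv h \<in> ?G"
    using group.generate_m_inv_closed[OF sym_group_on_group sub assms(1)]
    by (simp add: sym_group_on_inv[OF hp])
  show ?thesis
  proof
    show "?A \<subseteq> ?B"
    proof
      fix y assume "y \<in> ?A"
      then obtain g where g: "g \<in> ?G" "y = (g \<circ> h) x" by auto
      then show "y \<in> ?B" using comp[OF g(1) assms(1)] by blast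
    qed
    show "?B \<subseteq> ?A"
    proof
      fix y assume "y \<in> ?B"
      then obtain g where g: "g \<in> ?G" "y = g x" by blast
      then have "y = (g \<circ> Hilbert_Choice.inv h) (h x)"
        using hp by (simp add: permutes_inverses(2))
      then show "y \<in> ?A" using comp[OF g(1) hi] by blast
    qed
  qed
qed

lemma \<kappa>_le_if_refinement:
  assumes "collection_of_hypermaps S \<sigma> \<alpha>" "refinement S \<beta> \<alpha>"
  shows "\<kappa> S \<sigma> \<alpha> \<le> \<kappa> S \<sigma> \<beta>"
proof -
  let ?G = "generate (sym_group_on S) {\<sigma>, \<alpha>}"
  define F where "F = (\<lambda>x. {g x | g. g \<in> ?G})"
  have *: "finite S" "\<sigma> permutes S" "\<alpha> permutes S" "\<beta> permutes S"
    using assms by (auto simp: collection_of_hypermaps_def refinement_def)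
  have step: "F (h x) = F x" if "h \<in> ?G" for h x
    unfolding F_def using generate_orbit_eq[OF that *(2,3)] .
  have \<sigma>: "F (\<sigma> x) = F x" and \<alpha>: "F (\<alpha> x) = F x" for x
    by (rule step, rule generate.incl, simp)+
  have orb: "F y = F x" if "y \<in> Orbits.orbit \<alpha> x" for x y
    using that by (induction rule: Orbits.orbit.induct) (simp_all add: \<alpha>)
  have "F (\<beta> x) = F x" for x
  proof (cases "x \<in> S")
    case True
    have "x \<in> Orbits.orbit \<alpha> x"
      by (rule permutation_self_in_orbit) (use *(1,3) in \<open>auto simp: permutation_permutes\<close>)
    moreover have "\<beta> ` Orbits.orbit \<alpha> x = Orbits.orbit \<alpha> x"
      using assms(2) True by (auto simp: refinement_def cycles_def)
    ultimately show ?thesis using orb by blast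
  next
    case False
    then show ?thesis using *(4) by (simp add: permutes_not_in)
  qed
  then have "card (F ` S) \<le> \<kappa> S \<sigma> \<beta>" by (intro card_image_le_\<kappa> * \<sigma>)
  then show ?thesis by (simp add: \<kappa>_def hypermap_components_image F_def)
qed

lemma ex_merge:
  fixes f :: "'a \<Rightarrow> 'b"
  assumes "finite S" "finite G" "G \<subseteq> S \<times> S"
  shows "\<exists>m :: 'b \<Rightarrow> 'b. card (f ` S) \<le> card ((m \<circ> f) ` S) + card G \<and> (\<forall>(a, b) \<in> G. m (f a) = m (f b))"
  using assms(2,3)
proof (induction rule: finite_induct)
  case empty
  show ?case by (intro exI[of _ "\<lambda>v. v"]) (simp add: comp_def)
next
  case (insert e G)
  then obtain m :: "'b \<Rightarrow> 'b" where m: "card (f ` S) \<le> card ((m \<circ> f) ` S) + card G"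
    "\<forall>(a, b) \<in> G. m (f a) = m (f b)" by auto
  obtain a b where e: "e = (a, b)" by (cases e)
  define m' where "m' = (\<lambda>v. if m v = m (f b) then m (f a) else m v)"
  have "(m \<circ> f) ` S \<subseteq> insert (m (f b)) ((m' \<circ> f) ` S)" by (auto simp: m'_def)
  then have "card ((m \<circ> f) ` S) \<le> card (insert (m (f b)) ((m' \<circ> f) ` S))"
    using assms(1) by (intro card_mono) auto
  also have "\<dots> \<le> card ((m' \<circ> f) ` S) + 1" using assms(1) by (simp add: card_insert_if)
  finally have "card (f ` S) \<le> card ((m' \<circ> f) ` S) + card (insert e G)"
    using m(1) insert.hyps by simp
  moreover have "\<forall>(a, b) \<in> insert e G. m' (f a) = m' (f b)"
    using m(2) by (auto simp: m'_def e)
  ultimately show ?case by blast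
qed

lemma z_add_z_le:
  assumes "collection_of_hypermaps S \<sigma> \<beta>"
  shows "z S \<beta> + z S \<sigma> \<le> \<kappa> S \<sigma> \<beta> + card S"
proof -
  have *: "finite S" "\<sigma> permutes S" "\<beta> permutes S"
    using assms by (auto simp: collection_of_hypermaps_def)
  define r where "r = (\<lambda>x. SOME y. y \<in> Orbits.orbit \<beta> x)"
  have r: "r x \<in> Orbits.orbit \<beta> x" for x
    unfolding r_def by (rule someI) (rule Orbits.orbit.base)
  have r\<beta>: "r (\<beta> x) = r x" for x by (simp add: r_def orbit_apply_eq[OF *(1,3)])
  have rS: "r x \<in> S" if "x \<in> S" for x
    using r[of x] permutes_orbit_subset[OF *(3) that] by blast
  have orb: "Orbits.orbit \<beta> y = Orbits.orbit \<beta> x" if "y \<in> Orbits.orbit \<beta> x" for x y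
    using that by (induction rule: Orbits.orbit.induct) (simp_all add: orbit_apply_eq[OF *(1,3)])
  have rr: "r (r x) = r x" for x using orb[OF r, of x] by (simp add: r_def)
  have "cycles S \<beta> = Orbits.orbit \<beta> ` r ` S"
    using orb[OF r] by (simp add: cycles_def image_image)
  then have zr: "z S \<beta> \<le> card (r ` S)" using *(1) by (simp add: z_def card_image_le)
  define G where "G = (\<lambda>x. (x, r x)) ` (S - r ` S)"
  have G: "finite G" "G \<subseteq> S \<times> S" using *(1) rS by (auto simp: G_def)
  have rsub: "r ` S \<subseteq> S" using rS by blast
  have "card G \<le> card (S - r ` S)" unfolding G_def using *(1) by (intro card_image_le) auto
  also have "\<dots> = card S - card (r ` S)" using *(1) rsub by (intro card_Diff_subset) auto
  finally have cG: "card G + z S \<beta> \<le> card S"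
    using zr card_mono[OF *(1) rsub] by linarith
  obtain m :: "'a set \<Rightarrow> 'a set" where m: "card (Orbits.orbit \<sigma> ` S) \<le> card ((m \<circ> Orbits.orbit \<sigma>) ` S) + card G"
    "\<forall>(a, b) \<in> G. m (Orbits.orbit \<sigma> a) = m (Orbits.orbit \<sigma> b)"
    using ex_merge[OF *(1) G, of "Orbits.orbit \<sigma>"] by auto
  let ?F = "m \<circ> Orbits.orbit \<sigma>"
  have Fr: "?F (r x) = ?F x" if "x \<in> S" for x
  proof (cases "x \<in> r ` S")
    case True
    then show ?thesis using rr by auto
  next
    case False
    then have "(x, r x) \<in> G" using that by (simp add: G_def)
    then show ?thesis using m(2) by force
  qed
  have "card (?F ` S) \<le> \<kappa> S \<sigma> \<beta>"
  proof (rule card_image_le_\<kappa>[OF *])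
    show "?F (\<sigma> x) = ?F x" for x by (simp add: orbit_apply_eq[OF *(1,2)])
    show "?F (\<beta> x) = ?F x" for x
    proof (cases "x \<in> S")
      case True
      then have "\<beta> x \<in> S" using *(3) by (simp add: permutes_in_image)
      then show ?thesis using Fr[of x] Fr[of "\<beta> x"] True by (simp add: r\<beta>)
    next
      case False
      then show ?thesis using *(3) by (simp add: permutes_not_in)
    qed
  qed
  then show ?thesis using m(1) cG by (simp add: z_def cycles_def)
qed

end

theory Submission
  imports Defs
begin

text \<open>
  At \<open>u = 0\<close> only the refinements \<open>\<beta>\<close> with \<open>\<kappa>(\<sigma>, \<beta>) = \<kappa>(\<sigma>, \<alpha>)\<close> contribute; since the components of
  \<open>(\<sigma>, \<beta>)\<close> refine those of \<open>(\<sigma>, \<alpha>)\<close>, these are the spanning collections. The exponent of \<open>v\<close> is the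
  sum over the components \<open>C\<close> of \<open>(\<sigma>, \<beta>)\<close> of the nonnegative numbers \<open>|C| + 1 - z(\<beta>) - z(\<sigma>)\<close>, where
  \<open>z\<close> counts cycles in \<open>C\<close>. Such a number is zero for a unicellular component of genus zero. If
  conversely it is zero, then the component has only one face, and hence genus zero.
\<close>

section \<open>Components as orbits of the generated group\<close>

definition component :: "'a set \<Rightarrow> ('a \<Rightarrow> 'a) \<Rightarrow> ('a \<Rightarrow> 'a) \<Rightarrow> 'a \<Rightarrow> 'a set" where
  "component S \<sigma> \<alpha> x = {g x | g. g \<in> generate (sym_group_on S) {\<sigma>, \<alpha>}}"

lemma hypermap_components_eq: "hypermap_components S \<sigma> \<alpha> = component S \<sigma> \<alpha> ` S"
  unfolding hypermap_components_image component_def ..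

lemma \<kappa>_eq: "\<kappa> S \<sigma> \<alpha> = card (component S \<sigma> \<alpha> ` S)"
  by (simp add: \<kappa>_def hypermap_components_eq)

lemma self_in_component: "x \<in> component S \<sigma> \<alpha> x"
proof -
  have "id \<in> generate (sym_group_on S) {\<sigma>, \<alpha>}"
    using generate.one[of "sym_group_on S"] by (simp add: sym_group_on_def)
  then show ?thesis unfolding component_def by (intro CollectI exI[of _ id]) simp
qed

lemma component_nonempty: "component S \<sigma> \<alpha> x \<noteq> {}"
proof
  assume "component S \<sigma> \<alpha> x = {}"
  with self_in_component[of x S \<sigma> \<alpha>] show False by simp
qed

text \<open>To see that something is constant on components it suffices to check the two generators.
  Later \<open>F\<close> is a membership test, or is built from the component map of another
  pair.\<close>

lemma component_invariant:
  assumes "y \<in> component S \<sigma> \<alpha> x" "\<sigma> permutes S" "\<alpha> permutes S"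
    and "\<And>x. F (\<sigma> x) = F x" "\<And>x. F (\<alpha> x) = F x"
  shows "F y = F x"
  using assms(1) generate_invariant[where F = F, OF _ assms(2-5)]
  unfolding component_def by auto

lemma component_eq:
  assumes "y \<in> component S \<sigma> \<alpha> x" "\<sigma> permutes S" "\<alpha> permutes S"
  shows "component S \<sigma> \<alpha> y = component S \<sigma> \<alpha> x"
proof -
  obtain h where "h \<in> generate (sym_group_on S) {\<sigma>, \<alpha>}" "y = h x"
    using assms(1) unfolding component_def by blast
  then show ?thesis
    unfolding component_def using generate_orbit_eq[OF _ assms(2,3)] by simp
qed

lemma
  assumes "\<sigma> permutes S" "\<alpha> permutes S"
  shows component_left: "component S \<sigma> \<alpha> (\<sigma> x) = component S \<sigma> \<alpha> x"
    and component_right: "component S \<sigma> \<alpha> (\<alpha> x) = component S \<sigma> \<alpha> x"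
  unfolding component_def by (intro generate_orbit_eq generate.incl assms; simp)+

lemma component_subset:
  assumes "x \<in> S" "\<sigma> permutes S" "\<alpha> permutes S"
  shows "component S \<sigma> \<alpha> x \<subseteq> S"
proof
  fix y assume "y \<in> component S \<sigma> \<alpha> x"
  from component_invariant[where F = "\<lambda>x. x \<in> S", OF this assms(2,3)] assms
  show "y \<in> S" by (simp add: permutes_in_image)
qed

section \<open>Cycles and components under multiplication by a transposition\<close>

lemma permutes_orbit_eq:
  assumes "finite S" "p permutes S" "y \<in> Orbits.orbit p x"
  shows "Orbits.orbit p y = Orbits.orbit p x"
  using assms(3)
  by (induction rule: Orbits.orbit.induct) (simp_all add: orbit_apply_eq[OF assms(1,2)])

lemma permutes_self_in_orbit:
  assumes "finite S" "p permutes S"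
  shows "x \<in> Orbits.orbit p x"
  by (rule permutation_self_in_orbit) (use assms in \<open>auto simp: permutation_permutes\<close>)

text \<open>The transposition joins the two cycles of \<open>p\<close> through \<open>a\<close> and
  \<open>b\<close>. For the bound it suffices that every cycle of the product is a union of cycles
  of \<open>p\<close> and that these two land in the same one.\<close>

lemma z_transpose_comp:
  assumes "finite S" "p permutes S" "a \<in> S" "b \<in> S" "Orbits.orbit p a \<noteq> Orbits.orbit p b"
  shows "z S (transpose a b \<circ> p) + 1 \<le> z S p"
proof -
  define q where "q = transpose a b \<circ> p"
  have q: "q permutes S"
    unfolding q_def using assms by (intro permutes_compose permutes_swap_id)
  have a: "a \<notin> Orbits.orbit p b" using permutes_orbit_eq[OF assms(1,2)] assms(5) by blast
  \<comment> \<open>From \<open>b\<close>, \<open>q\<close> takes the same steps as \<open>p\<close>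
    until \<open>p\<close> returns to \<open>b\<close>; there \<open>q\<close> moves to
    \<open>a\<close> instead. For \<open>y = b\<close> only the second alternative survives.\<close>
  have "y \<noteq> b \<and> y \<in> Orbits.orbit q b \<or> a \<in> Orbits.orbit q b" if "y \<in> Orbits.orbit p b" for y
    using that
  proof (induction rule: Orbits.orbit.induct)
    case base
    have "p b \<noteq> a" using a Orbits.orbit.base[of p b] by auto
    then have "q b = (if p b = b then a else p b)" by (simp add: q_def transpose_def)
    then show ?case using Orbits.orbit.base[of q b] by (auto split: if_splits)
  next
    case (step y)
    have "p y \<noteq> a" using a Orbits.orbit.step[OF step.hyps] by auto
    then have "q y = (if p y = b then a else p y)" by (simp add: q_def transpose_def)
    then show ?case using step.IH Orbits.orbit.step[of y q b] by (auto split: if_splits)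
  qed
  from this[OF permutes_self_in_orbit[OF assms(1,2)]]
  have "a \<in> Orbits.orbit q b" by blast
  then have ab: "Orbits.orbit q a = Orbits.orbit q b" by (rule permutes_orbit_eq[OF assms(1) q])
  have qp: "Orbits.orbit q (p x) = Orbits.orbit q x" for x
  proof -
    have "Orbits.orbit q (p x) = Orbits.orbit q (q x)"
      using ab by (auto simp: q_def transpose_def)
    then show ?thesis by (simp add: orbit_apply_eq[OF assms(1) q])
  qed
  have orb: "Orbits.orbit q y = Orbits.orbit q x" if "y \<in> Orbits.orbit p x" for x y
    using that by (induction rule: Orbits.orbit.induct) (simp_all add: qp)
  \<comment> \<open>By \<open>orb\<close> all points of a \<open>p\<close>-cycle share one
    \<open>q\<close>-orbit, so the union is that single orbit.\<close>
  define h where "h = (\<lambda>A. \<Union>(Orbits.orbit q ` A))"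
  have h: "h (Orbits.orbit p x) = Orbits.orbit q x" for x
    unfolding h_def using orb Orbits.orbit.base[of p x] by (subst SUP_eq_const) auto
  have "cycles S q \<subseteq> h ` (cycles S p - {Orbits.orbit p a})"
  proof
    fix A assume "A \<in> cycles S q"
    then obtain x where x: "x \<in> S" "A = Orbits.orbit q x" by (auto simp: cycles_def)
    show "A \<in> h ` (cycles S p - {Orbits.orbit p a})"
    proof (cases "Orbits.orbit p x = Orbits.orbit p a")
      case True
      then have "A = h (Orbits.orbit p b)" by (metis h ab x(2))
      then show ?thesis using assms(4,5) by (auto simp: cycles_def)
    next
      case False
      then show ?thesis using x h by (force simp: cycles_def)
    qed
  qed
  moreover have fin: "finite (cycles S p)" using assms(1) by (simp add: cycles_def)
  ultimately have "z S q \<le> card (cycles S p - {Orbits.orbit p a})"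
    unfolding z_def by (intro surj_card_le) auto
  also have "\<dots> < z S p"
    unfolding z_def using fin assms(3) by (intro card_Diff1_less) (auto simp: cycles_def)
  finally show ?thesis by (simp add: q_def)
qed

text \<open>Once its values at \<open>a\<close> and \<open>b\<close> are identified, the component
  map of \<open>(\<sigma>, \<beta>)\<close> is invariant under both generators of the new pair, so
  its values number at most the new components. The identification costs at most one value, and none
  if the two values already agree.\<close>

lemma \<kappa>_le_\<kappa>_transpose_comp:
  assumes "finite S" "\<sigma> permutes S" "\<beta> permutes S" "a \<in> S" "b \<in> S"
  shows "\<kappa> S \<sigma> \<beta> \<le> \<kappa> S \<sigma> (transpose a b \<circ> \<beta>) + 1"
    and "component S \<sigma> \<beta> a = component S \<sigma> \<beta> b \<Longrightarrow>
      \<kappa> S \<sigma> \<beta> \<le> \<kappa> S \<sigma> (transpose a b \<circ> \<beta>)"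
proof -
  let ?c = "component S \<sigma> \<beta>"
  have t: "transpose a b \<circ> \<beta> permutes S"
    using assms by (intro permutes_compose permutes_swap_id)
  have le: "card ((m \<circ> ?c) ` S) \<le> \<kappa> S \<sigma> (transpose a b \<circ> \<beta>)" if "m (?c a) = m (?c b)"
    for m :: "'a set \<Rightarrow> 'a set"
  proof (rule card_image_le_\<kappa>[OF assms(1,2) t])
    have "m (?c (transpose a b x)) = m (?c x)" for x using that by (auto simp: transpose_def)
    then show "(m \<circ> ?c) ((transpose a b \<circ> \<beta>) x) = (m \<circ> ?c) x" for x
      by (simp add: component_right assms)
  qed (simp add: component_left assms)
  obtain m :: "'a set \<Rightarrow> 'a set" where
    m: "card (?c ` S) \<le> card ((m \<circ> ?c) ` S) + 1" "m (?c a) = m (?c b)"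
    using ex_merge[OF assms(1), of "{(a, b)}" ?c] assms(4,5) by auto
  show "\<kappa> S \<sigma> \<beta> \<le> \<kappa> S \<sigma> (transpose a b \<circ> \<beta>) + 1"
    using m le[of m] by (simp add: \<kappa>_eq)
  show "\<kappa> S \<sigma> \<beta> \<le> \<kappa> S \<sigma> (transpose a b \<circ> \<beta>)" if "?c a = ?c b"
    using le[of id] that by (simp add: \<kappa>_eq)
qed

section \<open>Faces in the extremal case\<close>

lemma orbit_id: "Orbits.orbit id x = {x}"
proof -
  have "y = x" if "y \<in> Orbits.orbit id x" for y
    using that by (induction rule: Orbits.orbit.induct) auto
  then show ?thesis using Orbits.orbit.base[of id x] by auto
qed

lemma z_le_\<kappa>_id:
  assumes "finite S" "\<sigma> permutes S"
  shows "z S \<sigma> \<le> \<kappa> S \<sigma> id"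
  unfolding z_def cycles_def
  by (rule card_image_le_\<kappa>) (simp_all add: assms permutes_id orbit_apply_eq[OF assms])

text \<open>
  If \<open>\<beta> = (a b) \<beta>'\<close> with \<open>a\<close> a fixed point of \<open>\<beta>'\<close>, the extremality hypothesis forces \<open>a\<close> and \<open>b\<close>
  into different components of \<open>(\<sigma>, \<beta>')\<close>, hence the transposition also joins two faces.
\<close>

lemma faces_le_if_extremal:
  assumes "finite S" "\<sigma> permutes S" "\<beta> permutes S" "\<kappa> S \<sigma> \<beta> + card S \<le> z S \<beta> + z S \<sigma>"
  shows "z S (Hilbert_Choice.inv \<beta> \<circ> \<sigma>) \<le> \<kappa> S \<sigma> \<beta>"
proof -
  \<comment> \<open>The induction is on a set \<open>T\<close> outside which \<open>\<beta>\<close>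
    is the identity; cycles, faces and components are counted in the fixed set \<open>S\<close>
    throughout.\<close>
  have "\<beta> permutes T \<Longrightarrow> \<kappa> S \<sigma> \<beta> + card S \<le> z S \<beta> + z S \<sigma> \<Longrightarrow>
    z S (Hilbert_Choice.inv \<beta> \<circ> \<sigma>) \<le> \<kappa> S \<sigma> \<beta>" if "T \<subseteq> S" for T \<beta>
    using finite_subset[OF that assms(1)] that
  proof (induction T arbitrary: \<beta> rule: finite_induct)
    case empty
    then have "\<beta> = id" by simp
    then show ?case using z_le_\<kappa>_id[OF assms(1,2)] by (simp only: inv_id id_comp)
  next
    case (insert a T)
    define b where "b = \<beta> a"
    define \<beta>' where "\<beta>' = transpose a b \<circ> \<beta>"
    have ab: "a \<in> S" "b \<in> S"
      using insert.prems permutes_in_image[of \<beta> "insert a T" a] by (auto simp: b_def)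
    have p': "\<beta>' permutes T"
      unfolding \<beta>'_def b_def by (rule permutes_insert_lemma[OF insert.prems(1)])
    then have pS: "\<beta>' permutes S" using insert.prems(3) by (auto intro: permutes_subset)
    have \<beta>: "\<beta> = transpose a b \<circ> \<beta>'" by (simp add: \<beta>'_def fun_eq_iff)
    have fix_a: "\<beta>' a = a" using p' insert.hyps by (simp add: permutes_not_in)
    show ?case
    proof (cases "b = a")
      case True
      then have "\<beta> = \<beta>'" by (simp add: \<beta>)
      then show ?thesis using insert p' by simp
    next
      case False
      have "y = a" if "y \<in> Orbits.orbit \<beta>' a" for y
        using that by (induction rule: Orbits.orbit.induct) (simp_all add: fix_a)
      then have "Orbits.orbit \<beta>' a \<noteq> Orbits.orbit \<beta>' b"
        using False permutes_self_in_orbit[OF assms(1) pS, of b] by auto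
      from z_transpose_comp[OF assms(1) pS ab this]
      have z: "z S \<beta> + 1 \<le> z S \<beta>'" by (simp add: \<beta>)
      \<comment> \<open>Splitting off \<open>a\<close> gains a cycle, so this bound forces
        \<open>\<kappa>\<close> to rise. Multiplying by the transposition accounts for a change of
        at most one, and for no rise at all if \<open>a\<close> and \<open>b\<close> share a
        component.\<close>
      have "z S \<beta>' + z S \<sigma> \<le> \<kappa> S \<sigma> \<beta>' + card S"
        by (rule z_add_z_le) (use assms pS in \<open>simp add: collection_of_hypermaps_def\<close>)
      with z insert.prems(2) have "\<kappa> S \<sigma> \<beta> + 1 \<le> \<kappa> S \<sigma> \<beta>'" by linarith
      with \<kappa>_le_\<kappa>_transpose_comp[OF assms(1,2) pS ab] have
        \<kappa>: "\<kappa> S \<sigma> \<beta>' = \<kappa> S \<sigma> \<beta> + 1" and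
        diff: "component S \<sigma> \<beta>' a \<noteq> component S \<sigma> \<beta>' b"
        by (auto simp: \<beta>)
      \<comment> \<open>\<open>\<beta>'\<close> is again extremal: \<open>z\<close> has grown by at
        least one and \<open>\<kappa>\<close> by exactly one.\<close>
      have IH: "z S (Hilbert_Choice.inv \<beta>' \<circ> \<sigma>) \<le> \<kappa> S \<sigma> \<beta>'"
        by (rule insert.IH) (use p' insert.prems \<kappa> z in auto)
      \<comment> \<open>Moving \<open>transpose a b\<close> across the inverse of
        \<open>\<beta>'\<close> turns it into \<open>transpose a' b'\<close>, so the faces of
        \<open>\<beta>\<close> are the cycles of \<open>transpose a' b' \<circ> q\<close>.\<close>
      define a' b' where "a' = Hilbert_Choice.inv \<beta>' a" and "b' = Hilbert_Choice.inv \<beta>' b"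
      have pi: "Hilbert_Choice.inv \<beta>' permutes S" by (rule permutes_inv[OF pS])
      have ab': "a' \<in> S" "b' \<in> S"
        using ab pi by (simp_all add: a'_def b'_def permutes_in_image)
      have ci: "component S \<sigma> \<beta>' (Hilbert_Choice.inv \<beta>' x) = component S \<sigma> \<beta>' x" for x
        using component_right[OF assms(2) pS, of "Hilbert_Choice.inv \<beta>' x"]
        by (simp add: permutes_inverses(1)[OF pS])
      define q where "q = Hilbert_Choice.inv \<beta>' \<circ> \<sigma>"
      have q: "q permutes S" unfolding q_def by (intro permutes_compose assms pi)
      \<comment> \<open>\<open>q\<close> preserves the components of
        \<open>(\<sigma>, \<beta>')\<close>, so points of different components lie in different
        \<open>q\<close>-cycles.\<close>
      have orb: "component S \<sigma> \<beta>' y = component S \<sigma> \<beta>' x" if "y \<in> Orbits.orbit q x" for x y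
        using that by (induction rule: Orbits.orbit.induct)
          (simp_all add: q_def ci component_left[OF assms(2) pS])
      have "component S \<sigma> \<beta>' a' \<noteq> component S \<sigma> \<beta>' b'"
        using diff by (simp only: a'_def b'_def ci not_False_eq_True)
      then have "a' \<notin> Orbits.orbit q b'" using orb by blast
      then have "Orbits.orbit q a' \<noteq> Orbits.orbit q b'"
        using permutes_self_in_orbit[OF assms(1) q, of a'] by auto
      from z_transpose_comp[OF assms(1) q ab' this]
      have "z S (transpose a' b' \<circ> q) \<le> \<kappa> S \<sigma> \<beta>" using IH \<kappa> by (simp add: q_def)
      moreover have "Hilbert_Choice.inv \<beta> \<circ> \<sigma> = transpose a' b' \<circ> q"
      proof -
        have "Hilbert_Choice.inv \<beta> = Hilbert_Choice.inv \<beta>' \<circ> transpose a b"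
          unfolding \<beta> by (subst o_inv_distrib) (simp_all add: permutes_bij[OF pS])
        also have "\<dots> = transpose a' b' \<circ> Hilbert_Choice.inv \<beta>'"
          unfolding a'_def b'_def
          by (auto simp: fun_eq_iff transpose_def permutes_inverses[OF pS] dest: permutes_inj[OF pi, THEN injD])
        finally show ?thesis by (simp add: q_def comp_assoc)
      qed
      ultimately show ?thesis by (simp only:)
    qed
  qed
  from this[OF subset_refl assms(3,4)] show ?thesis .
qed

section \<open>Restriction to components, additivity of cycle counts, hyperforests\<close>

lemma collection_restrict:
  assumes "collection_of_hypermaps S \<sigma> \<beta>" "C \<in> hypermap_components S \<sigma> \<beta>"
  shows "C \<subseteq> S" "C \<noteq> {}" "\<sigma> ` C \<subseteq> C" "\<beta> ` C \<subseteq> C"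
    and "collection_of_hypermaps C (perm_restrict \<sigma> C) (perm_restrict \<beta> C)"
proof -
  have *: "finite S" "\<sigma> permutes S" "\<beta> permutes S"
    using assms by (auto simp: collection_of_hypermaps_def)
  obtain x where x: "x \<in> S" "C = component S \<sigma> \<beta> x"
    using assms(2) by (auto simp: hypermap_components_eq)
  have C: "y \<in> C \<longleftrightarrow> component S \<sigma> \<beta> y = C" for y
    using component_eq[OF _ *(2,3)] self_in_component by (metis x(2))
  show sub: "C \<subseteq> S" unfolding x(2) by (rule component_subset) (use x * in auto)
  show "C \<noteq> {}" unfolding x(2) by (rule component_nonempty)
  show inv: "\<sigma> ` C \<subseteq> C" "\<beta> ` C \<subseteq> C"
    using C component_left[OF *(2,3)] component_right[OF *(2,3)] by auto
  have fin: "finite C" using sub *(1) by (rule finite_subset)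
  have "perm_restrict p C permutes C" if "p permutes S" "p ` C \<subseteq> C" for p
  proof (rule bij_imp_permutes)
    have "inj_on p C" using permutes_inj[OF that(1)] by (rule inj_on_subset) simp
    then have "bij_betw p C C" using endo_inj_surj[OF fin that(2)] by (simp add: bij_betw_def)
    then show "bij_betw (perm_restrict p C) C C"
      by (simp add: perm_restrict_simps cong: bij_betw_cong)
  qed (simp add: perm_restrict_simps)
  then show "collection_of_hypermaps C (perm_restrict \<sigma> C) (perm_restrict \<beta> C)"
    using fin inv * by (simp add: collection_of_hypermaps_def)
qed

text \<open>Elements of the two generated groups are not compared. Instead, the component map of the
  restricted pair is an invariant of the original pair, hence constant on \<open>C\<close>.\<close>

lemma \<kappa>_restrict_component:
  assumes "collection_of_hypermaps S \<sigma> \<beta>" "C \<in> hypermap_components S \<sigma> \<beta>"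
  shows "\<kappa> C (perm_restrict \<sigma> C) (perm_restrict \<beta> C) = 1"
proof -
  let ?s = "perm_restrict \<sigma> C" and ?b = "perm_restrict \<beta> C"
  have *: "\<sigma> permutes S" "\<beta> permutes S"
    using assms by (auto simp: collection_of_hypermaps_def)
  note C = collection_restrict[OF assms]
  have p: "?s permutes C" "?b permutes C" using C(5) by (auto simp: collection_of_hypermaps_def)
  obtain x where x: "x \<in> S" "C = component S \<sigma> \<beta> x"
    using assms(2) by (auto simp: hypermap_components_eq)
  \<comment> \<open>The empty set is a default value outside \<open>C\<close>; it makes
    \<open>F\<close> a function on all points, as \<open>component_invariant\<close>
    requires.\<close>
  define F where "F = (\<lambda>y. if y \<in> C then component C ?s ?b y else {})"
  \<comment> \<open>Invariance of \<open>F\<close> also needs that no point outside \<open>C\<close>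
    is mapped into \<open>C\<close>.\<close>
  have inC: "q y \<in> C \<longleftrightarrow> y \<in> C" if "q permutes S" "q ` C \<subseteq> C" "perm_restrict q C permutes C" for q y
  proof -
    have "q ` C = C"
      using permutes_image[OF that(3)] by (simp add: perm_restrict_simps cong: image_cong)
    then show ?thesis using permutes_inj[OF that(1)] by (metis inj_image_mem_iff)
  qed
  have eq: "F y = F x" if "y \<in> C" for y
  proof (rule component_invariant[OF _ *])
    show "y \<in> component S \<sigma> \<beta> x" using that x by simp
    show "F (\<sigma> y) = F y" for y
      using component_left[OF p, of y] inC[OF *(1) C(3) p(1)]
      by (auto simp: F_def perm_restrict_simps)
    show "F (\<beta> y) = F y" for y
      using component_right[OF p, of y] inC[OF *(2) C(4) p(2)]
      by (auto simp: F_def perm_restrict_simps)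
  qed
  have "component C ?s ?b ` C = F ` C" by (simp add: F_def cong: image_cong)
  also have "\<dots> = {F x}" using eq C(2) by auto
  finally show ?thesis by (simp add: \<kappa>_eq)
qed

lemma disjoint_components:
  assumes "\<sigma> permutes S" "\<beta> permutes S"
    and "C \<in> hypermap_components S \<sigma> \<beta>" "D \<in> hypermap_components S \<sigma> \<beta>" "C \<noteq> D"
  shows "C \<inter> D = {}"
proof (rule ccontr)
  assume "C \<inter> D \<noteq> {}"
  then obtain x where "x \<in> C" "x \<in> D" by blast
  moreover have "component S \<sigma> \<beta> x = E" if "x \<in> E" "E \<in> hypermap_components S \<sigma> \<beta>" for E
  proof -
    from that(2) obtain y where "E = component S \<sigma> \<beta> y" by (auto simp: hypermap_components_eq)
    then show ?thesis using component_eq[OF _ assms(1,2)] that(1) by simp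
  qed
  ultimately show False using assms(3-5) by metis
qed

lemma Union_components:
  assumes "\<sigma> permutes S" "\<beta> permutes S"
  shows "\<Union>(hypermap_components S \<sigma> \<beta>) = S"
  using component_subset[OF _ assms] self_in_component by (fastforce simp: hypermap_components_eq)

lemma orbit_perm_restrict:
  assumes "x \<in> C" "p ` C \<subseteq> C"
  shows "Orbits.orbit (perm_restrict p C) x = Orbits.orbit p x"
  by (rule orbit_cong0[OF assms(1)]) (use assms in \<open>auto simp: perm_restrict_simps\<close>)

text \<open>A cycle of \<open>p\<close> stays inside one component, so the cycles split into
  disjoint families. The general \<open>p\<close> covers both \<open>\<sigma>\<close> and
  \<open>\<beta>\<close>.\<close>

lemma z_eq_sum_components:
  assumes "collection_of_hypermaps S \<sigma> \<beta>" "p permutes S"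
    and "\<And>C. C \<in> hypermap_components S \<sigma> \<beta> \<Longrightarrow> p ` C \<subseteq> C"
  shows "z S p = (\<Sum>C\<in>hypermap_components S \<sigma> \<beta>. z C (perm_restrict p C))"
proof -
  let ?D = "hypermap_components S \<sigma> \<beta>"
  have *: "finite S" "\<sigma> permutes S" "\<beta> permutes S"
    using assms by (auto simp: collection_of_hypermaps_def)
  have cyc: "cycles C (perm_restrict p C) = Orbits.orbit p ` C" if "C \<in> ?D" for C
    using orbit_perm_restrict[OF _ assms(3)[OF that]] by (simp add: cycles_def cong: image_cong)
  have "cycles S p = (\<Union>C\<in>?D. Orbits.orbit p ` C)"
    using Union_components[OF *(2,3)] by (auto simp: cycles_def)
  also have "card \<dots> = (\<Sum>C\<in>?D. card (Orbits.orbit p ` C))"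
  proof (rule card_UN_disjoint)
    show "finite ?D" using *(1) by (simp add: hypermap_components_eq)
    show "\<forall>C\<in>?D. finite (Orbits.orbit p ` C)"
      using collection_restrict(1)[OF assms(1)] *(1) by (auto intro: finite_subset)
    have sub: "Orbits.orbit p x \<subseteq> C" if "x \<in> C" "C \<in> ?D" for x C
    proof
      fix y assume "y \<in> Orbits.orbit p x"
      then show "y \<in> C"
        by (induction rule: Orbits.orbit.induct) (use that assms(3) in auto)
    qed
    show "\<forall>C\<in>?D. \<forall>D\<in>?D. C \<noteq> D \<longrightarrow> Orbits.orbit p ` C \<inter> Orbits.orbit p ` D = {}"
    proof (intro ballI impI)
      fix C D assume CD: "C \<in> ?D" "D \<in> ?D" "C \<noteq> D"
      have "Orbits.orbit p x \<noteq> Orbits.orbit p y" if "x \<in> C" "y \<in> D" for x y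
        using sub[OF that(1) CD(1)] sub[OF that(2) CD(2)] disjoint_components[OF *(2,3) CD]
          Orbits.orbit.base[of p x] by auto
      then show "Orbits.orbit p ` C \<inter> Orbits.orbit p ` D = {}" by blast
    qed
  qed
  finally show ?thesis by (simp add: z_def cyc)
qed

text \<open>Both sides add up over the components, and \<open>z_add_z_le\<close> holds on each.
  Global equality is therefore equality on every component.\<close>

lemma hyperforest_iff:
  assumes "collection_of_hypermaps S \<sigma> \<beta>"
  shows "hyperforest S \<sigma> \<beta> \<longleftrightarrow> z S \<beta> + z S \<sigma> = \<kappa> S \<sigma> \<beta> + card S"
proof -
  let ?D = "hypermap_components S \<sigma> \<beta>"
  define e where "e C = z C (perm_restrict \<beta> C) + z C (perm_restrict \<sigma> C)" for C
  have *: "finite S" "\<sigma> permutes S" "\<beta> permutes S"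
    using assms by (auto simp: collection_of_hypermaps_def)
  note C = collection_restrict[OF assms]
  have finD: "finite ?D" using *(1) by (simp add: hypermap_components_eq)
  have e: "z S \<beta> + z S \<sigma> = (\<Sum>C\<in>?D. e C)"
    using z_eq_sum_components[OF assms *(2) C(3)] z_eq_sum_components[OF assms *(3) C(4)]
    by (simp add: e_def sum.distrib)
  have "card (\<Union>?D) = (\<Sum>C\<in>?D. card C)"
  proof (rule card_Union_disjoint)
    show "pairwise disjnt ?D"
      using disjoint_components[OF *(2,3)] by (simp add: pairwise_def disjnt_def)
    show "finite E" if "E \<in> ?D" for E by (rule finite_subset[OF C(1)[OF that] *(1)])
  qed
  then have n: "\<kappa> S \<sigma> \<beta> + card S = (\<Sum>C\<in>?D. card C + 1)"
    by (simp add: Union_components[OF *(2,3)] \<kappa>_def sum.distrib flip: One_nat_def)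
  have le: "e C \<le> card C + 1" if "C \<in> ?D" for C
    using z_add_z_le[OF C(5)[OF that]] \<kappa>_restrict_component[OF assms that] by (simp add: e_def)
  have "unicellular C (perm_restrict \<sigma> C) (perm_restrict \<beta> C) \<and>
      genus C (perm_restrict \<sigma> C) (perm_restrict \<beta> C) = 0 \<longleftrightarrow> e C = card C + 1"
    if "C \<in> ?D" for C
  proof -
    let ?f = "z C (Hilbert_Choice.inv (perm_restrict \<beta> C) \<circ> perm_restrict \<sigma> C)"
    have g: "genus C (perm_restrict \<sigma> C) (perm_restrict \<beta> C) = 0 \<longleftrightarrow> card C + 2 = e C + ?f"
    proof -
      have "genus C (perm_restrict \<sigma> C) (perm_restrict \<beta> C) = 0 \<longleftrightarrow>
          (of_nat (card C + 2) :: rat) = of_nat (e C + ?f)"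
        by (simp add: genus_def e_def algebra_simps)
      then show ?thesis by (simp only: of_nat_eq_iff)
    qed
    have Cp: "finite C" "perm_restrict \<sigma> C permutes C" "perm_restrict \<beta> C permutes C"
      using C(5)[OF that] by (auto simp: collection_of_hypermaps_def)
    \<comment> \<open>A component is nonempty and so has a face; in the extremal case
      \<open>\<kappa> = 1\<close> leaves at most one. With exactly one face, the equation in
      \<open>g\<close> reads \<open>e C = card C + 1\<close>.\<close>
    have "?f \<noteq> 0" using C(2)[OF that] Cp(1) by (simp add: z_def cycles_def)
    moreover have "?f \<le> 1" if "e C = card C + 1"
      using faces_le_if_extremal[OF Cp] \<kappa>_restrict_component[OF assms \<open>C \<in> ?D\<close>] that
      by (simp add: e_def)
    ultimately show ?thesis unfolding unicellular_def g by linarith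
  qed
  then have "hyperforest S \<sigma> \<beta> \<longleftrightarrow> (\<forall>C\<in>?D. e C = card C + 1)"
    using C(5) \<kappa>_restrict_component[OF assms] assms by (auto simp: hyperforest_def hypermap_def)
  \<comment> \<open>Termwise inequality with equal sums forces equality of every term.\<close>
  also have "\<dots> \<longleftrightarrow> (\<Sum>C\<in>?D. e C) = (\<Sum>C\<in>?D. card C + 1)"
    using sum_mono_inv[OF _ le _ finD] by (auto intro!: sum.cong)
  finally show ?thesis unfolding e n .
qed

section \<open>Spanning collections and evaluation of the polynomial\<close>

text \<open>\<open>\<beta>\<close> preserves the cycles of \<open>\<alpha>\<close>, so each
  component of \<open>(\<sigma>, \<beta>)\<close> lies in one of
  \<open>(\<sigma>, \<alpha>)\<close>. This gives a surjection of finite sets; with equal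
  cardinalities it is injective, and the two partitions agree.\<close>

lemma spanning_collection_iff:
  assumes "collection_of_hypermaps S \<sigma> \<alpha>" "refinement S \<beta> \<alpha>"
  shows "spanning_collection S \<sigma> \<alpha> \<beta> \<longleftrightarrow> \<kappa> S \<sigma> \<beta> = \<kappa> S \<sigma> \<alpha>"
proof
  assume "spanning_collection S \<sigma> \<alpha> \<beta>"
  then show "\<kappa> S \<sigma> \<beta> = \<kappa> S \<sigma> \<alpha>" by (simp add: spanning_collection_def \<kappa>_def)
next
  assume \<kappa>: "\<kappa> S \<sigma> \<beta> = \<kappa> S \<sigma> \<alpha>"
  let ?A = "component S \<sigma> \<alpha>" and ?B = "component S \<sigma> \<beta>"
  have *: "finite S" "\<sigma> permutes S" "\<alpha> permutes S" "\<beta> permutes S"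
    using assms by (auto simp: collection_of_hypermaps_def refinement_def)
  have orb: "?A y = ?A x" if "y \<in> Orbits.orbit \<alpha> x" for x y
    using that by (induction rule: Orbits.orbit.induct) (simp_all add: component_right[OF *(2,3)])
  have A\<beta>: "?A (\<beta> x) = ?A x" for x
  proof (cases "x \<in> S")
    case True
    then have "\<beta> ` Orbits.orbit \<alpha> x = Orbits.orbit \<alpha> x"
      using assms(2) by (auto simp: refinement_def cycles_def)
    then show ?thesis using orb permutes_self_in_orbit[OF *(1,3)] by blast
  qed (use *(4) in \<open>simp add: permutes_not_in\<close>)
  have AB: "?A y = ?A x" if "y \<in> ?B x" for x y
    by (rule component_invariant[OF that *(2,4)]) (simp_all add: component_left[OF *(2,3)] A\<beta>)
  \<comment> \<open>\<open>?A\<close> is constant on a component of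
    \<open>(\<sigma>, \<beta>)\<close>, so the union there has a single value, the component of
    \<open>(\<sigma>, \<alpha>)\<close> containing it.\<close>
  define h where "h = (\<lambda>X. \<Union>(?A ` X))"
  have h: "h (?B x) = ?A x" for x
    unfolding h_def by (rule SUP_eq_const[OF component_nonempty AB])
  have "h ` ?B ` S = ?A ` S" by (simp add: image_image h)
  then have inj: "inj_on h (?B ` S)"
    using \<kappa> *(1) by (intro eq_card_imp_inj_on) (simp_all add: \<kappa>_eq)
  have "?B x = ?A x" if "x \<in> S" for x
  proof
    show "?B x \<subseteq> ?A x" using AB self_in_component[of _ S \<sigma> \<alpha>] by auto
    show "?A x \<subseteq> ?B x"
    proof
      fix y assume y: "y \<in> ?A x"
      then have "y \<in> S" using component_subset[OF that *(2,3)] by blast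
      moreover have "h (?B y) = h (?B x)" unfolding h by (rule component_eq[OF y *(2,3)])
      ultimately have "?B y = ?B x" using that by (auto dest: inj_onD[OF inj])
      then show "y \<in> ?B x" using self_in_component[of y S \<sigma> \<beta>] by simp
    qed
  qed
  then show "spanning_collection S \<sigma> \<alpha> \<beta>"
    using assms(2) by (simp add: spanning_collection_def hypermap_components_eq cong: image_cong)
qed

lemma eval_uv_whitney_polynomial:
  "eval_uv (whitney_polynomial S \<sigma> \<alpha>) u v =
    (\<Sum>\<beta> | refinement S \<beta> \<alpha>.
      u ^ (\<kappa> S \<sigma> \<beta> - \<kappa> S \<sigma> \<alpha>) * v ^ (\<kappa> S \<sigma> \<beta> + card S - z S \<beta> - z S \<sigma>))"
  by (simp add: eval_uv_def whitney_polynomial_def poly_sum poly_monom poly_power mult.commute)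

theorem proposition2p15:
  fixes S :: "'a set" and \<sigma> \<alpha> :: "'a \<Rightarrow> 'a"
  assumes "collection_of_hypermaps S \<sigma> \<alpha>"
  shows "eval_uv (whitney_polynomial S \<sigma> \<alpha>) 0 0 = int (card {\<beta>. spanning_hyperforest S \<sigma> \<alpha> \<beta>}) \<and>
         eval_uv (whitney_polynomial S \<sigma> \<alpha>) 0 1 = int (card {\<beta>. spanning_collection S \<sigma> \<alpha> \<beta>})"
proof -
  let ?R = "{\<beta>. refinement S \<beta> \<alpha>}"
  let ?k = "\<lambda>\<beta>. \<kappa> S \<sigma> \<beta> - \<kappa> S \<sigma> \<alpha>" and ?e = "\<lambda>\<beta>. \<kappa> S \<sigma> \<beta> + card S - z S \<beta> - z S \<sigma>"
  have fin: "finite ?R"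
    by (rule finite_subset[OF _ finite_permutations[of S]])
      (use assms in \<open>auto simp: refinement_def collection_of_hypermaps_def\<close>)
  \<comment> \<open>For both exponents the earlier inequalities exclude truncation, so a zero
    difference is a genuine equality.\<close>
  have k: "?k \<beta> = 0 \<longleftrightarrow> spanning_collection S \<sigma> \<alpha> \<beta>" if "refinement S \<beta> \<alpha>" for \<beta>
    using \<kappa>_le_if_refinement[OF assms that] spanning_collection_iff[OF assms that] by auto
  have e: "?e \<beta> = 0 \<longleftrightarrow> hyperforest S \<sigma> \<beta>" if "refinement S \<beta> \<alpha>" for \<beta>
  proof -
    have c: "collection_of_hypermaps S \<sigma> \<beta>"
      using assms that by (simp add: collection_of_hypermaps_def refinement_def)
    show ?thesis using z_add_z_le[OF c] hyperforest_iff[OF c] by auto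
  qed
  have sc: "{\<beta>. spanning_collection S \<sigma> \<alpha> \<beta>} = {\<beta> \<in> ?R. ?k \<beta> = 0}"
    using k by (auto simp: spanning_collection_def)
  have sh: "{\<beta>. spanning_hyperforest S \<sigma> \<alpha> \<beta>} = {\<beta> \<in> ?R. ?k \<beta> = 0 \<and> ?e \<beta> = 0}"
    using k e by (auto simp: spanning_hyperforest_def spanning_collection_def)
  \<comment> \<open>Cardinalities become sums of indicators over the refinements. They match the
    polynomial termwise, since \<open>0 ^ k\<close> is the indicator of \<open>k = 0\<close>, with
    \<open>0 ^ 0 = 1\<close>, and \<open>1 ^ k = 1\<close>.\<close>
  have count: "int (card {\<beta> \<in> ?R. P \<beta>}) = (\<Sum>\<beta>\<in>?R. if P \<beta> then 1 else 0)" for P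
    using fin by (simp add: sum.If_cases Int_def)
  show ?thesis unfolding sc sh count eval_uv_whitney_polynomial
    by (intro conjI sum.cong refl) (simp_all add: power_0_left)
qed

end
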